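(* Let $G$ be a finite simple graph that is $(\mathcal{F}\cup\{P_5\})$-free, i.e. no graph in $\mathcal{F}$ is isomorphic to an induced subgraph of $G$, and $P_5$ is not isomorphic to an induced subgraph of $G$. Then every application of the Maxine heuristic to $G$ produces a maximum independent set of $G$; that is, the independent set it produces has size $\alpha(G)$.
   Context: All graphs are finite and simple. $\alpha(G)$ is the independence number of $G$, $\overline{H}$ is the complement of the graph $H$, $P_n$ is the path on $n$ vertices, and $C_n$ is the cycle on $n$ vertices ($n\ge 3$). For a set $U$ of vertices, $G[U]$ is the induced subgraph on $U$. Maxine heuristic: starting from $G$, iteratively delete a vertex of maximum degree in the current graph (any choice among the maximum-degree vertices is allowed) until the remaining vertices form an independent set. This remaining set is the independent set produced. An application of the heuristic is any run of this procedure, with any choices of deleted vertices. The family $\mathcal{F}$: $\mathcal{F}$ is the set of all graphs $H$ (up to isomorphism) whose vertex set is a disjoint union $\{u,v,w\}\cup N'\cup Q'$, with $u,v,w$ distinct, such that - $u,v,w$ are pairwise non-adjacent; - $v$ is adjacent to every vertex of $N'\cup Q'$; - every vertex of $N'$ is adjacent to both $u$ and $w$; - every vertex of $Q'$ is adjacent to exactly one of $u$ and $w$; and at least one of the following holds: 1. $|Q'|=0$ and $H[N']\cong\overline{C_n}$ for some $n\ge 3$; 2. $|Q'|=1$ and $H[N'\cup Q']\cong\overline{C_n}$ for some $n\ge 3$; 3. $|Q'|=2$ and $H[N'\cup Q']\cong\overline{P_n}$ for some $n\ge 3$, where the two elements of $Q'$ are the endpoints of the path $P_n$ in the complement. *)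

theory Defs
  imports "Graph_Theory.Graph_Theory"
begin

text \<open>
  Finite simple graphs are the \<^locale>\<open>graph\<close>s of Graph_Theory: finite symmetric digraphs without
  loops and without parallel arcs. Every undirected edge is a pair of opposite arcs, so the degree
  of a vertex is its \<^const>\<open>out_degree\<close>, and digraph isomorphism and induced subgraphs have their
  usual undirected meaning.
\<close>

definition independent_set :: "('a, 'b) pre_digraph \<Rightarrow> 'a set \<Rightarrow> bool" where
  "independent_set G S \<longleftrightarrow> S \<subseteq> verts G \<and> (\<forall>x\<in>S. \<forall>y\<in>S. \<not> x \<rightarrow>\<^bsub>G\<^esub> y)"

definition independence_number :: "('a, 'b) pre_digraph \<Rightarrow> nat" where
  "independence_number G = Max (card ` {S. independent_set G S})"

definition complement_graph :: "('a, 'b) pre_digraph \<Rightarrow> ('a, 'a \<times> 'a) pre_digraph" where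
  "complement_graph G = with_proj \<lparr> pverts = verts G,
     parcs = {(x, y). x \<in> verts G \<and> y \<in> verts G \<and> x \<noteq> y \<and> \<not> x \<rightarrow>\<^bsub>G\<^esub> y} \<rparr>"

definition path_graph :: "nat \<Rightarrow> (nat, nat \<times> nat) pre_digraph" where
  "path_graph n = with_proj \<lparr> pverts = {..<n},
     parcs = {(i, j). i < n \<and> j < n \<and> (j = i + 1 \<or> i = j + 1)} \<rparr>"

text \<open>Only meant for \<open>n \<ge> 3\<close>; for smaller \<open>n\<close> this is not the cycle of length \<open>n\<close>.\<close>

definition cycle_graph :: "nat \<Rightarrow> (nat, nat \<times> nat) pre_digraph" where
  "cycle_graph n = with_proj \<lparr> pverts = {..<n},
     parcs = {(i, j). i < n \<and> j < n \<and> (j = (i + 1) mod n \<or> i = (j + 1) mod n)} \<rparr>"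

definition free_of :: "('a, 'b) pre_digraph \<Rightarrow> ('c, 'd) pre_digraph set \<Rightarrow> bool" where
  "free_of G \<H> \<longleftrightarrow> \<not> (\<exists>H\<in>\<H>. \<exists>K. induced_subgraph K G \<and> digraph_iso H K)"

text \<open>
  Completed runs of the Maxine heuristic: \<open>maxine G I\<close> holds iff some run started on \<open>G\<close> stops with
  remaining vertex set \<open>I\<close>. The deleted vertex is an arbitrary vertex of maximum degree in the
  current graph, and the run stops as soon as the remaining vertices are independent.
\<close>

inductive maxine :: "('a, 'b) pre_digraph \<Rightarrow> 'a set \<Rightarrow> bool" where
  stop: "independent_set G (verts G) \<Longrightarrow> maxine G (verts G)"
| delete: "\<not> independent_set G (verts G) \<Longrightarrow> v \<in> verts G \<Longrightarrow>
    \<forall>x\<in>verts G. out_degree G x \<le> out_degree G v \<Longrightarrow>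
    maxine (pre_digraph.del_vert G v) I \<Longrightarrow> maxine G I"

text \<open>
  The family is given by all its members with vertices in \<^typ>\<open>nat\<close> and arcs in
  \<^typ>\<open>nat \<times> nat\<close>. Every finite simple graph has an isomorphic copy of this form, and \<^const>\<open>free_of\<close>
  only depends on the isomorphism types in the family.

  In the last alternative the isomorphism \<open>f\<close> is explicit because \<open>Q\<close> has to consist of the
  images of the two endpoints \<open>0\<close> and \<open>n - 1\<close> of the path.
\<close>

definition family_F :: "(nat, nat \<times> nat) pre_digraph set" where
  "family_F = {H. graph H \<and> (\<exists>u v w N Q.
     distinct [u, v, w] \<and> {u, v, w} \<inter> N = {} \<and> {u, v, w} \<inter> Q = {} \<and> N \<inter> Q = {} \<and>
     verts H = {u, v, w} \<union> N \<union> Q \<and>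
     independent_set H {u, v, w} \<and>
     (\<forall>x\<in>N \<union> Q. v \<rightarrow>\<^bsub>H\<^esub> x) \<and>
     (\<forall>x\<in>N. x \<rightarrow>\<^bsub>H\<^esub> u \<and> x \<rightarrow>\<^bsub>H\<^esub> w) \<and>
     (\<forall>x\<in>Q. (x \<rightarrow>\<^bsub>H\<^esub> u) \<noteq> (x \<rightarrow>\<^bsub>H\<^esub> w)) \<and>
     (card Q = 0 \<and> (\<exists>n\<ge>3. digraph_iso (complement_graph (cycle_graph n)) (H \<restriction> N)) \<or>
      card Q = 1 \<and> (\<exists>n\<ge>3. digraph_iso (complement_graph (cycle_graph n)) (H \<restriction> (N \<union> Q))) \<or>
      card Q = 2 \<and> (\<exists>n\<ge>3. \<exists>f.
        pre_digraph.digraph_isomorphism (complement_graph (path_graph n)) f \<and>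
        H \<restriction> (N \<union> Q) = app_iso f (complement_graph (path_graph n)) \<and>
        Q = iso_verts f ` {0, n - 1})))}"

end

theory Submission
  imports Defs
begin

text \<open>
  The heuristic only fails if some deletion lowers the independence number, so it suffices to
  show that for a vertex \<open>v\<close> of maximum degree every independent set \<open>I\<close> can be traded for one of
  at least the same size that avoids \<open>v\<close> (\<open>independent_set_avoiding_max_degree_vertex\<close>). Both
  hypotheses on the graph pass to induced subgraphs, and induction along the run does the rest.

  Suppose that no such trade is possible for \<open>I\<close>; then \<open>v \<in> I\<close>. Let \<open>A\<close> be the neighbourhood of
  \<open>v\<close>, let \<open>R\<close> be non-adjacency on \<open>A\<close>, and for \<open>x \<in> A\<close> let \<open>S x\<close> be the set of neighbours of \<open>x\<close>
  in \<open>I - {v}\<close>. Three facts turn the problem into one about the set system \<open>S\<close> on the graph \<open>R\<close>.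
  \<^item> Replacing \<open>v\<close> and \<open>S x\<close> by \<open>x\<close> in \<open>I\<close> makes the set smaller, so every \<open>S x\<close> is non-empty. In
    the same way, \<open>S x \<union> S y\<close> has at least two elements if \<open>R x y\<close>.
  \<^item> The degree of \<open>x\<close> is at most that of \<open>v\<close>. As \<open>x\<close> has \<open>|S x| + 1\<close> neighbours outside \<open>A\<close>, it
    has at least \<open>|S x|\<close> neighbours with respect to \<open>R\<close>.
  \<^item> If \<open>R x y\<close>, then \<open>S x\<close> and \<open>S y\<close> are comparable: otherwise \<open>a \<in> S x - S y\<close> and
    \<open>b \<in> S y - S x\<close> yield the induced path \<open>a, x, v, y, b\<close>.

  These facts force two elements \<open>u, w\<close> and a member of the family around \<open>u, v, w\<close>
  (\<open>ex_F_pattern_set_system\<close>). Take \<open>x\<^sub>0\<close> with \<open>|S x\<^sub>0|\<close> maximum and let \<open>K\<close> be the set of all \<open>x\<close>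
  with \<open>S x = S x\<^sub>0\<close>; all \<open>R\<close>-neighbours \<open>y\<close> of \<open>K\<close> satisfy \<open>S y \<subseteq> S x\<^sub>0\<close>. If \<open>S x\<^sub>0 = {u, w}\<close>, the
  neighbours outside \<open>K\<close> form an \<open>R\<close>-independent set of vertices \<open>y\<close> with \<open>S y = {u}\<close> or
  \<open>S y = {w}\<close>. Every vertex of \<open>K\<close> has two \<open>R\<close>-neighbours, and a longest induced path with inner
  vertices in \<open>K\<close> either ends outside \<open>K\<close> on both sides or closes up to an induced cycle
  (\<open>ex_F_pattern\<close>). If \<open>|S x\<^sub>0| \<ge> 3\<close>, then either each vertex of \<open>K\<close> has two \<open>R\<close>-neighbours inside
  \<open>K\<close>, and there is a cycle in \<open>K\<close>, or some \<open>x \<in> K\<close> has two \<open>R\<close>-neighbours outside \<open>K\<close>, and these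
  three vertices already form a triangle or a path of the required kind.
\<close>

unbundle no funcset_syntax

section \<open>Induced paths and cycles\<close>

definition induced_path :: "('a \<Rightarrow> 'a \<Rightarrow> bool) \<Rightarrow> nat \<Rightarrow> (nat \<Rightarrow> 'a) \<Rightarrow> bool" where
  "induced_path R n p \<longleftrightarrow> inj_on p {..<n} \<and>
     (\<forall>i<n. \<forall>j<n. R (p i) (p j) \<longleftrightarrow> j = i + 1 \<or> i = j + 1)"

definition induced_cycle :: "('a \<Rightarrow> 'a \<Rightarrow> bool) \<Rightarrow> nat \<Rightarrow> (nat \<Rightarrow> 'a) \<Rightarrow> bool" where
  "induced_cycle R n c \<longleftrightarrow> inj_on c {..<n} \<and>
     (\<forall>i<n. \<forall>j<n. R (c i) (c j) \<longleftrightarrow> j = (i + 1) mod n \<or> i = (j + 1) mod n)"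

text \<open>
  The shape of the members of the family around a centre \<open>v\<close>: \<open>R\<close> is non-adjacency among the
  neighbours of \<open>v\<close>, \<open>K\<close> consists of the neighbours that are adjacent to both \<open>u\<close> and \<open>w\<close>, and \<open>L\<close>
  of those that are adjacent to exactly one of them. A cycle with no or one vertex in \<open>L\<close> covers the
  first two alternatives, a path with its end vertices in \<open>L\<close> is the third one.
\<close>

definition F_pattern :: "('a \<Rightarrow> 'a \<Rightarrow> bool) \<Rightarrow> 'a set \<Rightarrow> 'a set \<Rightarrow> nat \<Rightarrow> (nat \<Rightarrow> 'a) \<Rightarrow> bool" where
  "F_pattern R K L n q \<longleftrightarrow> 3 \<le> n \<and> q ` {..<n} \<subseteq> K \<union> L \<and>
     (induced_cycle R n q \<and> (\<forall>i<n. \<forall>j<n. q i \<in> L \<longrightarrow> q j \<in> L \<longrightarrow> i = j) \<or>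
      induced_path R n q \<and> (\<forall>i<n. q i \<in> L \<longleftrightarrow> i = 0 \<or> i = n - 1))"

lemma F_pattern_mono:
  assumes "F_pattern R K L n q" "K \<subseteq> K'" "L \<subseteq> L'" "K' \<inter> L' = {}"
  shows "F_pattern R K' L' n q"
proof -
  have q: "q i \<in> K \<union> L" if "i < n" for i
    using assms(1) that by (auto simp: F_pattern_def)
  have "q i \<in> L' \<longleftrightarrow> q i \<in> L" if "i < n" for i
    using q[OF that] assms(2-4) by blast
  then show ?thesis
    using assms(1-3) unfolding F_pattern_def by blast
qed

lemma induced_path_rev:
  assumes "induced_path R n p"
  shows "induced_path R n (\<lambda>i. p (n - 1 - i))"
proof -
  have inj: "p i = p j \<longleftrightarrow> i = j" if "i < n" "j < n" for i j
    using assms that by (auto simp: induced_path_def inj_on_def)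
  have adj: "R (p i) (p j) \<longleftrightarrow> j = i + 1 \<or> i = j + 1" if "i < n" "j < n" for i j
    using assms that by (auto simp: induced_path_def)
  show ?thesis
    unfolding induced_path_def inj_on_def by (auto simp: inj adj)
qed

lemma induced_path_snoc:
  assumes "induced_path R n p" "symp R" "\<not> R z z" "z \<notin> p ` {..<n}" "1 \<le> n"
    and "\<And>i. i < n \<Longrightarrow> R (p i) z \<longleftrightarrow> i = n - 1"
  shows "induced_path R (n + 1) (p(n := z))"
proof -
  have adj: "R (p i) (p j) \<longleftrightarrow> j = i + 1 \<or> i = j + 1" if "i < n" "j < n" for i j
    using assms that by (auto simp: induced_path_def)
  have zR: "R z (p i) \<longleftrightarrow> i = n - 1" if "i < n" for i
    using assms(2) assms(6)[OF that] by (metis sympD)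
  have "R ((p(n := z)) i) ((p(n := z)) j) \<longleftrightarrow> j = i + 1 \<or> i = j + 1"
    if "i < n + 1" "j < n + 1" for i j
    using that assms(3,5,6) adj zR by (cases "i = n"; cases "j = n") auto
  moreover have "inj_on (p(n := z)) {..<n + 1}"
    using assms(1,4) by (auto simp: induced_path_def inj_on_def less_Suc_eq)
  ultimately show ?thesis by (simp add: induced_path_def)
qed

lemma induced_cycle_close:
  assumes p: "induced_path R n p" and "symp R" "\<not> R z z" "z \<notin> p ` {..<n}"
    and "j + 2 \<le> n" and l: "l = n - j + 1"
    and z: "\<And>i. i < n \<Longrightarrow> j \<le> i \<Longrightarrow> R (p i) z \<longleftrightarrow> i = j \<or> i = n - 1"
  shows "induced_cycle R l (\<lambda>i. if i < n - j then p (j + i) else z)"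
    (is "induced_cycle R l ?c")
proof -
  have adj: "R (p i) (p k) \<longleftrightarrow> k = i + 1 \<or> i = k + 1" if "i < n" "k < n" for i k
    using p that by (auto simp: induced_path_def)
  have zR: "R z (p i) \<longleftrightarrow> i = j \<or> i = n - 1" if "i < n" "j \<le> i" for i
    using assms(2) z[OF that] by (metis sympD)
  have md: "(i + 1) mod l = (if i = n - j then 0 else i + 1)" if "i < l" for i
    using that l by auto
  have "R (?c i) (?c k) \<longleftrightarrow> k = (i + 1) mod l \<or> i = (k + 1) mod l" if "i < l" "k < l" for i k
    unfolding md[OF that(1)] md[OF that(2)]
    using that assms(3,5) l adj[of "j + i" "j + k"] z[of "j + i"] zR[of "j + k"]
    by (cases "i < n - j"; cases "k < n - j") auto
  moreover have "inj_on ?c {..<l}"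
    using p assms(4) l by (fastforce simp: induced_path_def inj_on_def)
  ultimately show ?thesis by (simp add: induced_cycle_def)
qed

text \<open>
  Consider a longest induced path whose inner vertices belong to \<open>K\<close>. If an end vertex belongs to
  \<open>K\<close>, it has a second neighbour \<open>z\<close>, and \<open>z\<close> does not extend the path, so it is adjacent to an
  earlier vertex and closes an induced cycle. On this cycle only \<open>z\<close> and the other end of the path
  can be in \<open>L\<close>; if both lie on it, they are adjacent, so at most one is in \<open>L\<close>. Otherwise both ends are in \<open>L\<close>,
  and the path itself is as required.
\<close>

lemma ex_F_pattern:
  assumes fin: "finite (K \<union> L)" and disj: "K \<inter> L = {}" and "K \<noteq> {}"
    and sym: "symp R" and irr: "\<And>x. \<not> R x x"
    and indep: "\<And>x y. x \<in> L \<Longrightarrow> y \<in> L \<Longrightarrow> \<not> R x y"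
    and deg: "\<And>x. x \<in> K \<Longrightarrow> 2 \<le> card {y \<in> K \<union> L. R x y}"
  shows "\<exists>n q. F_pattern R K L n q"
proof (rule ccontr)
  assume no: "\<not> ?thesis"
  define P where "P n p \<longleftrightarrow> 2 \<le> n \<and> induced_path R n p \<and> p ` {..<n} \<subseteq> K \<union> L \<and>
    (\<forall>i. 0 < i \<longrightarrow> i < n - 1 \<longrightarrow> p i \<in> K)" for n p
  have other: "\<exists>z\<in>K \<union> L. R x z \<and> z \<noteq> y" if "x \<in> K" for x y
  proof (rule ccontr)
    assume "\<not> ?thesis"
    then have "{y \<in> K \<union> L. R x y} \<subseteq> {y}" by blast
    then have "card {y \<in> K \<union> L. R x y} \<le> card {y}" by (intro card_mono) auto
    then show False using deg[OF that] by simp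
  qed
  obtain k where k: "k \<in> K" using \<open>K \<noteq> {}\<close> by blast
  with other obtain z where z: "z \<in> K \<union> L" "R k z" by blast
  have "induced_path R 2 (\<lambda>i. if i = 0 then k else z)"
    using z irr sym by (auto simp: induced_path_def inj_on_def less_2_cases_iff dest: sympD)
  then have "P 2 (\<lambda>i. if i = 0 then k else z)"
    using k z by (auto simp: P_def)
  moreover have bound: "n \<le> card (K \<union> L)" if "P n p" for n p
    using that card_inj_on_le[of p "{..<n}" "K \<union> L"] fin by (auto simp: P_def induced_path_def)
  ultimately have "P 2 (\<lambda>i. if i = 0 then k else z)" and "\<forall>m. (\<exists>p. P m p) \<longrightarrow> m \<le> card (K \<union> L)"
    by blast+
  then obtain n where n: "\<exists>p. P n p" and max: "\<And>m p. P m p \<Longrightarrow> m \<le> n"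
    using GreatestI_nat[of "\<lambda>n. \<exists>p. P n p" 2 "card (K \<union> L)"]
      Greatest_le_nat[of "\<lambda>n. \<exists>p. P n p" _ "card (K \<union> L)"] by blast
  have end_L: "p (n - 1) \<in> L" if p: "P n p" for p
  proof (rule ccontr)
    assume "p (n - 1) \<notin> L"
    have n2: "2 \<le> n" and ip: "induced_path R n p"
      and pKL: "\<And>i. i < n \<Longrightarrow> p i \<in> K \<union> L" and inner: "\<And>i. 0 < i \<Longrightarrow> i < n - 1 \<Longrightarrow> p i \<in> K"
      using p by (auto simp: P_def)
    have lastK: "p (n - 1) \<in> K" using pKL[of "n - 1"] n2 \<open>p (n - 1) \<notin> L\<close> by auto
    obtain z where z: "z \<in> K \<union> L" "R (p (n - 1)) z" "z \<noteq> p (n - 2)"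
      using other[OF lastK] by blast
    have znew: "z \<notin> p ` {..<n}"
    proof
      assume "z \<in> p ` {..<n}"
      then obtain i where "i < n" "z = p i" by blast
      then have "i = n - 2" using ip z(2) n2 by (auto simp: induced_path_def)
      then show False using z(3) \<open>z = p i\<close> by simp
    qed
    \<comment> \<open>If \<open>z\<close> has no neighbour among the earlier vertices, the path can be extended.\<close>
    define J where "J = {j. j < n - 1 \<and> R (p j) z}"
    show False
    proof (cases "J = {}")
      case True
      then have zR: "R (p i) z \<longleftrightarrow> i = n - 1" if "i < n" for i
        using that z(2) by (cases "i = n - 1") (auto simp: J_def)
      have "induced_path R (n + 1) (p(n := z))"
        by (rule induced_path_snoc[OF ip sym irr znew _ zR]) (use n2 in auto)
      moreover have "(p(n := z)) i \<in> K" if "0 < i" "i < n" for i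
        using that inner[of i] lastK by (cases "i = n - 1") auto
      moreover have "(p(n := z)) i \<in> K \<union> L" if "i < n + 1" for i
        using that pKL[of i] z(1) by (cases "i = n") auto
      ultimately have "P (n + 1) (p(n := z))"
        using n2 unfolding P_def image_subset_iff by auto
      then show False using max by fastforce
    next
      case False
      \<comment> \<open>The last such neighbour gives a cycle without chords.\<close>
      define j where "j = Max J"
      have "finite J" by (simp add: J_def)
      then have jJ: "j \<in> J" and jmax: "\<And>i. i \<in> J \<Longrightarrow> i \<le> j"
        using False by (auto simp: j_def)
      have zR: "R (p i) z \<longleftrightarrow> i = j \<or> i = n - 1" if "i < n" "j \<le> i" for i
        using that z(2) jJ jmax[of i] by (auto simp: J_def)
      define c where "c = (\<lambda>i. if i < n - j then p (j + i) else z)"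
      have jn: "j + 2 \<le> n" using jJ by (auto simp: J_def)
      have cyc: "induced_cycle R (n - j + 1) c"
        unfolding c_def by (rule induced_cycle_close[OF ip sym irr znew jn refl zR])
      have cL: "i = 0 \<or> i = n - j" if "i < n - j + 1" "c i \<in> L" for i
      proof (rule ccontr)
        assume i: "\<not> ?thesis"
        then have "c i = p (j + i)" "0 < j + i" "j + i \<le> n - 1" using that(1) by (auto simp: c_def)
        then have "c i \<in> K" using inner[of "j + i"] lastK by (cases "j + i = n - 1") auto
        then show False using that(2) disj by blast
      qed
      have ends: "\<not> (c 0 \<in> L \<and> c (n - j) \<in> L)"
        using indep[of "p j" z] jJ jn by (auto simp: c_def J_def)
      have "i = k" if "i < n - j + 1" "k < n - j + 1" "c i \<in> L" "c k \<in> L" for i k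
        using cL[of i] cL[of k] ends that by auto
      moreover have "c i \<in> K \<union> L" if "i < n - j + 1" for i
        using pKL[of "j + i"] z(1) by (auto simp: c_def)
      ultimately have "F_pattern R K L (n - j + 1) c"
        unfolding F_pattern_def image_subset_iff using cyc jn by auto
      then show False using no by blast
    qed
  qed
  obtain p where p: "P n p" using n by blast
  have "P n (\<lambda>i. p (n - 1 - i))"
    using p induced_path_rev[of R n p] unfolding P_def image_subset_iff lessThan_iff by auto
  from end_L[OF this] have first: "p 0 \<in> L" by simp
  note last = end_L[OF p]
  have ip: "induced_path R n p" and n2: "2 \<le> n" using p by (auto simp: P_def)
  have "n \<noteq> 2"
  proof
    assume "n = 2"
    then have "R (p 0) (p (n - 1))" using ip by (auto simp: induced_path_def)
    then show False using indep first last by blast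
  qed
  moreover have "p i \<in> L \<longleftrightarrow> i = 0 \<or> i = n - 1" if "i < n" for i
  proof (cases "i = 0 \<or> i = n - 1")
    case False
    then have "p i \<in> K" using p that by (auto simp: P_def)
    then show ?thesis using False disj by blast
  qed (use first last in auto)
  ultimately have "F_pattern R K L n p"
    using p by (auto simp: F_pattern_def P_def)
  then show False using no by blast
qed

section \<open>Set systems that are nested along edges\<close>

text \<open>
  Neighbours of a vertex with a largest set carry subsets of that set, which leaves few possibilities
  for them. In every case the pattern comes from a suitable choice of \<open>K\<close> and \<open>L\<close> in the
  lemma \<open>ex_F_pattern\<close>, also when it is just a triangle or a path on three vertices.
\<close>

lemma ex_F_pattern_set_system:
  fixes S :: "'a \<Rightarrow> 'b set"
  assumes fin: "finite A" and "A \<noteq> {}"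
    and sym: "symp R" and irr: "\<And>x. \<not> R x x"
    and finS: "\<And>x. x \<in> A \<Longrightarrow> finite (S x)" and ne: "\<And>x. x \<in> A \<Longrightarrow> S x \<noteq> {}"
    and deg: "\<And>x. x \<in> A \<Longrightarrow> card (S x) \<le> card {y \<in> A. R x y}"
    and chain: "\<And>x y. x \<in> A \<Longrightarrow> y \<in> A \<Longrightarrow> R x y \<Longrightarrow> S x \<subseteq> S y \<or> S y \<subseteq> S x"
    and two: "\<And>x y. x \<in> A \<Longrightarrow> y \<in> A \<Longrightarrow> R x y \<Longrightarrow> 2 \<le> card (S x \<union> S y)"
  shows "\<exists>x\<in>A. \<exists>u\<in>S x. \<exists>w\<in>S x. u \<noteq> w \<and>
    (\<exists>n q. F_pattern R {y\<in>A. u \<in> S y \<and> w \<in> S y} {y\<in>A. (u \<in> S y) \<noteq> (w \<in> S y)} n q)"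
proof -
  have pattern: ?thesis
    if "x \<in> A" "u \<in> S x" "w \<in> S x" "u \<noteq> w" "K \<noteq> {}"
      and K: "\<And>y. y \<in> K \<Longrightarrow> y \<in> A \<and> u \<in> S y \<and> w \<in> S y"
      and L: "\<And>y. y \<in> L \<Longrightarrow> y \<in> A \<and> (u \<in> S y) \<noteq> (w \<in> S y)"
      and indep: "\<And>y z. y \<in> L \<Longrightarrow> z \<in> L \<Longrightarrow> \<not> R y z"
      and deg: "\<And>y. y \<in> K \<Longrightarrow> 2 \<le> card {z \<in> K \<union> L. R y z}"
    for x u w K L
  proof -
    have "finite (K \<union> L)" using fin K L by (meson Un_iff finite_subset subsetI)
    moreover have "K \<inter> L = {}" using K L by blast
    ultimately obtain n q where "F_pattern R K L n q"
      using ex_F_pattern[OF _ _ \<open>K \<noteq> {}\<close> sym irr indep deg] by blast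
    then have "F_pattern R {y\<in>A. u \<in> S y \<and> w \<in> S y} {y\<in>A. (u \<in> S y) \<noteq> (w \<in> S y)} n q"
      by (rule F_pattern_mono) (use K L in auto)
    then show ?thesis using that(1-4) by blast
  qed
  define s where "s = Max ((\<lambda>x. card (S x)) ` A)"
  obtain x0 where x0: "x0 \<in> A" "card (S x0) = s"
  proof -
    have "s \<in> (\<lambda>x. card (S x)) ` A" using fin \<open>A \<noteq> {}\<close> unfolding s_def by (intro Max_in) auto
    then show ?thesis using that by blast
  qed
  have s_max: "card (S x) \<le> s" if "x \<in> A" for x
    using that fin by (simp add: s_def)
  have "2 \<le> s"
  proof -
    have "1 \<le> card (S x0)" using x0(1) finS ne by (simp add: Suc_le_eq card_gt_0_iff)
    then have "card {y \<in> A. R x0 y} \<noteq> 0" using deg[OF x0(1)] by linarith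
    then have "{y \<in> A. R x0 y} \<noteq> {}" by (metis card.empty)
    then obtain y where y: "y \<in> A" "R x0 y" by blast
    have "S x0 \<union> S y = S x0 \<or> S x0 \<union> S y = S y" using chain[OF x0(1) y] by blast
    then show ?thesis using two[OF x0(1) y] s_max[OF x0(1)] s_max[OF y(1)] by auto
  qed
  define K where "K = {x \<in> A. S x = S x0}"
  have x0K: "x0 \<in> K" using x0 by (simp add: K_def)
  have below: "S y \<subseteq> S x0" if "x \<in> K" "y \<in> A" "R x y" for x y
  proof -
    have "S x0 \<subseteq> S y \<or> S y \<subseteq> S x0" using chain[of x y] that by (auto simp: K_def)
    moreover have "S y = S x0" if "S x0 \<subseteq> S y"
      using card_seteq[of "S y" "S x0"] that finS[OF \<open>y \<in> A\<close>] s_max[OF \<open>y \<in> A\<close>] x0(2) by simp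
    ultimately show ?thesis by blast
  qed
  have degK: "s \<le> card {y \<in> A. R x y}" if "x \<in> K" for x
    using deg[of x] that x0(2) by (auto simp: K_def)
  show ?thesis
  proof (cases "s = 2")
    case True
    then obtain u w where uw: "S x0 = {u, w}" "u \<noteq> w"
      using x0(2) by (auto simp: card_2_iff)
    \<comment> \<open>A neighbour of \<open>K\<close> outside \<open>K\<close> carries a non-empty proper subset of \<open>{u, w}\<close>.\<close>
    define L where "L = {y \<in> A. S y = {u} \<or> S y = {w}}"
    show ?thesis
    proof (rule pattern[of x0 u w K L])
      show "\<not> R y z" if "y \<in> L" "z \<in> L" for y z
      proof
        assume R: "R y z"
        have "y \<in> A" "z \<in> A" using that by (auto simp: L_def)
        then have "S y = S z" using chain[OF _ _ R] that uw(2) by (auto simp: L_def)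
        then show False using two[OF \<open>y \<in> A\<close> \<open>z \<in> A\<close> R] that by (auto simp: L_def)
      qed
      show "2 \<le> card {z \<in> K \<union> L. R y z}" if "y \<in> K" for y
      proof -
        have "z \<in> K \<union> L" if z: "z \<in> A" "R y z" for z
        proof -
          have "S z \<subseteq> {u, w}" using below[OF \<open>y \<in> K\<close> z] uw by simp
          then have "S z = {u, w} \<or> S z = {u} \<or> S z = {w}" using ne[OF z(1)] by blast
          then show ?thesis using z(1) uw by (auto simp: K_def L_def)
        qed
        then have "{z \<in> A. R y z} \<subseteq> {z \<in> K \<union> L. R y z}" by blast
        moreover have "finite {z \<in> K \<union> L. R y z}" using fin by (auto simp: K_def L_def)
        ultimately show ?thesis using degK[OF that] True card_mono by (metis order.trans)
      qed
    qed (use x0 x0K uw in \<open>auto simp: K_def L_def\<close>)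
  next
    case False
    show ?thesis
    proof (cases "\<exists>x\<in>K. \<exists>y\<in>A - K. \<exists>z\<in>A - K. y \<noteq> z \<and> R x y \<and> R x z")
      case True
      \<comment> \<open>By symmetry the smaller set can be assumed to be \<open>S y\<close>.\<close>
      then obtain x y z where x: "x \<in> K" and yA: "y \<in> A" "y \<notin> K" and zA: "z \<in> A" "z \<notin> K"
        and yz: "y \<noteq> z" and Rx: "R x y" "R x z"
        and le: "card (S y) \<le> card (S z)"
        by (metis DiffE nle_le)
      have xA: "x \<in> A" and Sx: "S x = S x0" using x by (auto simp: K_def)
      have sub: "S y \<subset> S x" "S z \<subset> S x"
        using below[OF x yA(1) Rx(1)] below[OF x zA(1) Rx(2)] yA zA Sx by (auto simp: K_def)
      have xyz: "x \<noteq> y" "x \<noteq> z" using Rx irr by auto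
      have Rb: "R y x" "R z x" using Rx sym by (auto dest: sympD)
      show ?thesis
      proof (cases "R y z")
        case False
        \<comment> \<open>The path \<open>y, x, z\<close>: some \<open>u, w \<in> S x\<close> are separated both by \<open>S y\<close> and by \<open>S z\<close>.\<close>
        then have nR: "\<not> R y z" "\<not> R z y" using sym by (auto dest: sympD)
        obtain u w where uw: "u \<in> S x" "w \<in> S x" "u \<noteq> w"
          "(u \<in> S y) \<noteq> (w \<in> S y)" "(u \<in> S z) \<noteq> (w \<in> S z)"
        proof (cases "S y \<subseteq> S z")
          case True
          obtain u where "u \<in> S y" using ne[OF yA(1)] by blast
          moreover obtain w where "w \<in> S x" "w \<notin> S z" using sub(2) by blast
          ultimately show ?thesis using that[of u w] True sub(1) by blast
        next
          case False
          then obtain u where "u \<in> S y" "u \<notin> S z" by blast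
          moreover obtain w where "w \<in> S z" "w \<notin> S y"
          proof -
            have "\<not> S z \<subseteq> S y"
              using card_seteq[OF finS[OF yA(1)], of "S z"] le False by auto
            then show ?thesis using that by blast
          qed
          ultimately show ?thesis using that[of u w] sub by blast
        qed
        have "{v \<in> {x} \<union> {y, z}. R x v} = {y, z}" using Rx irr by auto
        then show ?thesis
          by (intro pattern[of x u w "{x}" "{y, z}"])
             (use uw xA yA zA yz nR irr in auto)
      next
        case True
        then have Rzy: "R z y" using sym by (auto dest: sympD)
        have yz_sub: "S y \<subseteq> S z"
          using chain[OF yA(1) zA(1) True] card_seteq[OF finS[OF yA(1)], of "S z"] le by auto
        show ?thesis
        proof (cases "card (S y) = 1")
          case one: True
          \<comment> \<open>The triangle \<open>x, y, z\<close>: \<open>S x\<close> and \<open>S z\<close> contain \<open>u, w\<close>, but \<open>S y\<close> only \<open>u\<close>.\<close>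
          then obtain u where u: "S y = {u}" by (auto simp: card_1_singleton_iff)
          have "S y \<noteq> S z" using two[OF yA(1) zA(1) True] one by auto
          then obtain w where w: "w \<in> S z" "w \<notin> S y" using yz_sub by blast
          have "{v \<in> {x, z} \<union> {y}. R x v} = {y, z}" "{v \<in> {x, z} \<union> {y}. R z v} = {x, y}"
            using Rx Rb Rzy irr by auto
          then show ?thesis
            by (intro pattern[of x u w "{x, z}" "{y}"])
               (use u w yz_sub sub xA yA zA yz xyz irr in auto)
        next
          case not_one: False
          \<comment> \<open>The triangle \<open>x, y, z\<close>: all three sets contain any two elements of \<open>S y\<close>.\<close>
          have "card (S y) \<noteq> 0" using ne[OF yA(1)] finS[OF yA(1)] by simp
          then have "\<not> card (S y) \<le> 1" using not_one by simp
          then obtain u w where u: "u \<in> S y" "w \<in> S y" "u \<noteq> w"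
            using finS[OF yA(1)] by (auto simp: card_le_Suc0_iff_eq)
          have "{v \<in> {x, y, z} \<union> {}. R x v} = {y, z}" "{v \<in> {x, y, z} \<union> {}. R z v} = {x, y}"
            "{v \<in> {x, y, z} \<union> {}. R y v} = {x, z}"
            using Rx Rb Rzy True irr by auto
          then show ?thesis
            by (intro pattern[of x u w "{x, y, z}" "{}"])
               (use u yz_sub sub xA yA zA yz xyz irr in auto)
        qed
      qed
    next
      case one_out: False
      \<comment> \<open>Each vertex of \<open>K\<close> has at least \<open>3\<close> neighbours, and at most one of them outside \<open>K\<close>.\<close>
      have "\<not> card (S x0) \<le> 1" using \<open>2 \<le> s\<close> x0 by simp
      then obtain u w where uw: "u \<in> S x0" "w \<in> S x0" "u \<noteq> w"
        using finS[OF x0(1)] by (auto simp: card_le_Suc0_iff_eq)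
      show ?thesis
      proof (rule pattern[of x0 u w K "{}"])
        show "2 \<le> card {z \<in> K \<union> {}. R y z}" if "y \<in> K" for y
        proof -
          have "{z \<in> A. R y z} = {z \<in> K. R y z} \<union> {z \<in> A - K. R y z}" by (auto simp: K_def)
          moreover have "card {z \<in> A - K. R y z} \<le> 1"
            using one_out that fin by (simp add: card_le_Suc0_iff_eq) blast
          ultimately have "s \<le> card {z \<in> K. R y z} + 1"
            using degK[OF that] card_Un_le[of "{z \<in> K. R y z}" "{z \<in> A - K. R y z}"] by simp
          then show ?thesis using \<open>2 \<le> s\<close> \<open>s \<noteq> 2\<close> by simp
        qed
      qed (use x0 x0K uw in \<open>auto simp: K_def\<close>)
    qed
  qed
qed

section \<open>Labelled copies of induced subgraphs\<close>

text \<open>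
  Without parallel arcs the action on the arcs is determined by the action on the vertices.
\<close>

lemma digraph_iso_bijI:
  assumes A: "nomulti_digraph A" and B: "nomulti_digraph B"
    and bij: "bij_betw \<phi> (verts A) (verts B)"
    and adj: "\<And>x y. x \<in> verts A \<Longrightarrow> y \<in> verts A \<Longrightarrow> x \<rightarrow>\<^bsub>A\<^esub> y \<longleftrightarrow> \<phi> x \<rightarrow>\<^bsub>B\<^esub> \<phi> y"
  shows "digraph_iso A B"
proof -
  interpret A: nomulti_digraph A by fact
  interpret B: nomulti_digraph B by fact
  define ends where "ends a = map_prod \<phi> \<phi> (arc_to_ends A a)" for a
  define g where "g a = the_inv_into (arcs B) (arc_to_ends B) (ends a)" for a
  have inj: "inj_on \<phi> (verts A)" and img: "\<phi> ` verts A = verts B"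
    using bij by (auto simp: bij_betw_def)
  have ends: "ends a \<in> arcs_ends B" if "a \<in> arcs A" for a
    using that adj[of "tail A a" "head A a"] A.dominatesI[of a]
    by (auto simp: ends_def arc_to_ends_def)
  have g: "g a \<in> arcs B" "arc_to_ends B (g a) = ends a" if "a \<in> arcs A" for a
    using ends[OF that] B.inj_on_arc_to_ends unfolding g_def arcs_ends_def
    by (auto intro: the_inv_into_into f_the_inv_into_f)
  have "inj_on g (arcs A)"
  proof (rule inj_onI)
    fix a b assume ab: "a \<in> arcs A" "b \<in> arcs A" "g a = g b"
    then have "ends a = ends b" using g(2) by metis
    then have "arc_to_ends A a = arc_to_ends A b"
      using ab inj by (auto simp: ends_def arc_to_ends_def inj_on_def)
    then show "a = b" using ab A.no_multi_arcs by blast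
  qed
  moreover have "arcs B \<subseteq> g ` arcs A"
  proof
    fix b assume b: "b \<in> arcs B"
    obtain x y where xy: "x \<in> verts A" "y \<in> verts A" "\<phi> x = tail B b" "\<phi> y = head B b"
      using b img B.wellformed by (metis imageE)
    then have "\<phi> x \<rightarrow>\<^bsub>B\<^esub> \<phi> y" using b by (auto simp: arc_to_ends_def intro: B.dominatesI)
    then obtain a where a: "a \<in> arcs A" "tail A a = x" "head A a = y"
      using adj[OF xy(1,2)] by (metis reachableE)
    then have "arc_to_ends B (g a) = arc_to_ends B b"
      using g(2)[OF a(1)] xy by (simp add: ends_def arc_to_ends_def)
    then have "g a = b" using B.no_multi_arcs g(1) a(1) b by blast
    then show "b \<in> g ` arcs A" using a(1) by blast
  qed
  ultimately have "A.digraph_isomorphism \<lparr>iso_verts = \<phi>, iso_arcs = g, iso_head = head B, iso_tail = tail B\<rparr>"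
    "B = app_iso \<lparr>iso_verts = \<phi>, iso_arcs = g, iso_head = head B, iso_tail = tail B\<rparr> A"
    using inj img g A.wf_digraph
    by (auto simp: A.digraph_isomorphism_def app_iso_def ends_def arc_to_ends_def image_subset_iff
        intro!: pre_digraph.equality)
  then show ?thesis by (auto simp: digraph_iso_def)
qed

text \<open>
  The subgraph induced by \<open>h 0, \<dots>, h (n - 1)\<close>, transported to the labels \<open>0, \<dots>, n - 1\<close>. Pairs of
  labels serve as arcs, so copies of paths, cycles and their complements are equal to the standard
  graphs and not only isomorphic to them.
\<close>

definition labelled_copy :: "('a, 'b) pre_digraph \<Rightarrow> nat \<Rightarrow> (nat \<Rightarrow> 'a) \<Rightarrow> (nat, nat \<times> nat) pre_digraph" where
  "labelled_copy G n h = with_proj \<lparr> pverts = {..<n},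
     parcs = {(i, j). i < n \<and> j < n \<and> h i \<rightarrow>\<^bsub>G\<^esub> h j} \<rparr>"

lemma labelled_copy_eqI:
  assumes "\<And>i j. i < n \<Longrightarrow> j < n \<Longrightarrow> h i \<rightarrow>\<^bsub>G\<^esub> h j \<longleftrightarrow> P i j"
  shows "labelled_copy G n h =
    with_proj \<lparr> pverts = {..<n}, parcs = {(i, j). i < n \<and> j < n \<and> P i j} \<rparr>"
  using assms by (auto simp: labelled_copy_def intro!: arg_cong[where f = with_proj])

context graph
begin

lemma adj_sym: "x \<rightarrow> y \<longleftrightarrow> y \<rightarrow> x"
  using arcs_ends_symmetric[OF sym_arcs] by blast

lemma graph_labelled_copy: "graph (labelled_copy G n h)"
proof -
  have "finite {(i, j). i < n \<and> j < n \<and> h i \<rightarrow> h j}"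
    by (rule finite_subset[of _ "{..<n} \<times> {..<n}"]) auto
  then show ?thesis
    unfolding labelled_copy_def
    by unfold_locales (auto simp: arc_to_ends_def symmetric_def sym_def adj_sym dest: adj_not_same)
qed

lemma induce_labelled_copy:
  assumes "m \<le> n"
  shows "labelled_copy G n h \<restriction> {..<m} = labelled_copy G m h"
  using assms by (auto simp: labelled_copy_def with_proj_def induce_subgraph_def)

lemma free_of_labelled_copy:
  assumes "free_of G \<H>" "inj_on h {..<n}" "h ` {..<n} \<subseteq> verts G"
  shows "labelled_copy G n h \<notin> \<H>"
proof -
  let ?X = "h ` {..<n}"
  interpret C: graph "labelled_copy G n h" by (rule graph_labelled_copy)
  interpret K: digraph "G \<restriction> ?X" using assms(3) by (intro digraphI_induced induced_induce)
  have "arcs_ends (G \<restriction> ?X) = {e \<in> arcs_ends G. fst e \<in> ?X \<and> snd e \<in> ?X}"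
    unfolding arcs_ends_conv by auto
  then have "digraph_iso (labelled_copy G n h) (G \<restriction> ?X)"
    by (intro digraph_iso_bijI[where \<phi> = h] C.nomulti_digraph K.nomulti_digraph)
       (use assms(2) in \<open>auto simp: bij_betw_def labelled_copy_def\<close>)
  moreover have "induced_subgraph (G \<restriction> ?X) G" using assms(3) by (rule induced_induce)
  ultimately show ?thesis using assms(1) by (auto simp: free_of_def)
qed

lemma path_graph_labelled_copy:
  assumes "induced_path (dominates G) n p"
  shows "labelled_copy G n p = path_graph n"
  using assms unfolding path_graph_def induced_path_def by (intro labelled_copy_eqI) blast

lemma complement_cycle_labelled_copy:
  assumes "induced_cycle (\<lambda>x y. x \<noteq> y \<and> \<not> x \<rightarrow> y) n c"
  shows "labelled_copy G n c = complement_graph (cycle_graph n)"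
proof -
  have "c i \<rightarrow> c j \<longleftrightarrow> i \<noteq> j \<and> \<not> (j = (i + 1) mod n \<or> i = (j + 1) mod n)" if "i < n" "j < n" for i j
    using assms that adj_not_same[of "c i"] by (auto simp: induced_cycle_def inj_on_def)
  from labelled_copy_eqI[of n, OF this] show ?thesis
    by (auto simp: complement_graph_def cycle_graph_def intro!: arg_cong[where f = with_proj])
qed

lemma complement_path_labelled_copy:
  assumes "induced_path (\<lambda>x y. x \<noteq> y \<and> \<not> x \<rightarrow> y) n p"
  shows "labelled_copy G n p = complement_graph (path_graph n)"
proof -
  have "p i \<rightarrow> p j \<longleftrightarrow> i \<noteq> j \<and> \<not> (j = i + 1 \<or> i = j + 1)" if "i < n" "j < n" for i j
    using assms that adj_not_same[of "p i"] by (auto simp: induced_path_def inj_on_def)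
  from labelled_copy_eqI[of n, OF this] show ?thesis
    by (auto simp: complement_graph_def path_graph_def intro!: arg_cong[where f = with_proj])
qed

section \<open>Recognising members of the family\<close>

text \<open>
  The vertices of the pattern receive the labels \<open>0, \<dots>, n - 1\<close>, and \<open>v, u, w\<close> the labels
  \<open>n, n + 1, n + 2\<close>. The subgraph of the labelled copy on the first \<open>n\<close> labels is then the
  complement of the standard cycle or path, and the identity is the isomorphism.
\<close>

lemma F_pattern_family_F:
  assumes indep: "independent_set G {u, v, w}" and dist: "distinct [u, v, w]"
    and pat: "F_pattern (\<lambda>x y. x \<noteq> y \<and> \<not> x \<rightarrow> y)
      {x. v \<rightarrow> x \<and> x \<rightarrow> u \<and> x \<rightarrow> w} {x. v \<rightarrow> x \<and> (x \<rightarrow> u) \<noteq> (x \<rightarrow> w)} n q"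
  shows "\<not> free_of G family_F"
proof
  assume free: "free_of G family_F"
  define h where "h i = (if i < n then q i else [v, u, w] ! (i - n))" for i
  let ?H = "labelled_copy G (n + 3) h"
  define N where "N = {i. i < n \<and> q i \<rightarrow> u \<and> q i \<rightarrow> w}"
  define Q where "Q = {i. i < n \<and> (q i \<rightarrow> u) \<noteq> (q i \<rightarrow> w)}"
  have vq: "v \<rightarrow> q i" and cases: "i \<in> N \<union> Q" if "i < n" for i
    using pat that by (auto simp: F_pattern_def N_def Q_def)
  have NQ: "N \<union> Q = {..<n}" using cases by (auto simp: N_def Q_def)
  have n3: "3 \<le> n" using pat by (simp add: F_pattern_def)
  have nadj: "\<not> x \<rightarrow> y" if "x \<in> {u, v, w}" "y \<in> {u, v, w}" for x y
    using indep that by (auto simp: independent_set_def)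
  have qnew: "q i \<notin> {u, v, w}" if "i < n" for i
    using vq[OF that] nadj[of v] by auto
  have inj: "inj_on q {..<n}" using pat by (auto simp: F_pattern_def induced_cycle_def induced_path_def)
  have h: "h i = q i" if "i < n" for i using that by (simp add: h_def)
  have h3: "h n = v" "h (n + 1) = u" "h (n + 2) = w" by (auto simp: h_def)
  have lt: "i < n + 3 \<longleftrightarrow> i < n \<or> i = n \<or> i = n + 1 \<or> i = n + 2" for i by auto
  have "inj_on h {..<n + 3}"
  proof (rule inj_onI)
    fix i j assume "i \<in> {..<n + 3}" "j \<in> {..<n + 3}" and eq: "h i = h j"
    then have "i < n \<or> i = n \<or> i = n + 1 \<or> i = n + 2" "j < n \<or> j = n \<or> j = n + 1 \<or> j = n + 2"
      by auto
    then show "i = j"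
      using eq inj qnew[of i] qnew[of j] dist
      by (elim disjE) (simp_all add: h h3[simplified] inj_on_def)
  qed
  moreover have "h ` {..<n + 3} \<subseteq> verts G"
  proof -
    have "{u, v, w} \<subseteq> verts G" using indep by (simp add: independent_set_def)
    moreover have "q i \<in> verts G" if "i < n" for i using vq[OF that] by (rule adj_in_verts)
    ultimately show ?thesis using h h3 by (auto simp: lt)
  qed
  ultimately have "?H \<notin> family_F" by (rule free_of_labelled_copy[OF free])
  moreover have "?H \<in> family_F"
  proof -
    have adj: "i \<rightarrow>\<^bsub>?H\<^esub> j \<longleftrightarrow> i < n + 3 \<and> j < n + 3 \<and> h i \<rightarrow> h j" for i j
      by (simp add: labelled_copy_def)
    have restr: "?H \<restriction> {..<n} = labelled_copy G n q"
      using induce_labelled_copy[of n "n + 3" h] labelled_copy_eqI[of n h G "\<lambda>i j. q i \<rightarrow> q j"] h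
      by (simp add: labelled_copy_def)
    have finQ: "finite Q" by (simp add: Q_def)
    have Qn: "i < n" if "i \<in> Q" for i using that by (simp add: Q_def)
    let ?id = "\<lparr>iso_verts = id, iso_arcs = id, iso_head = snd, iso_tail = fst\<rparr>"
    have iso: "pre_digraph.digraph_isomorphism (labelled_copy G n q) ?id"
      "app_iso ?id (labelled_copy G n q) = labelled_copy G n q"
    proof -
      interpret C: graph "labelled_copy G n q" by (rule graph_labelled_copy)
      show "C.digraph_isomorphism ?id" "app_iso ?id (labelled_copy G n q) = labelled_copy G n q"
        using C.wf_digraph
        by (auto simp: pre_digraph.digraph_isomorphism_def app_iso_def labelled_copy_def with_proj_def)
    qed
    have "card Q = 0 \<and> (\<exists>n\<ge>3. digraph_iso (complement_graph (cycle_graph n)) (?H \<restriction> N)) \<or>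
      card Q = 1 \<and> (\<exists>n\<ge>3. digraph_iso (complement_graph (cycle_graph n)) (?H \<restriction> (N \<union> Q))) \<or>
      card Q = 2 \<and> (\<exists>n\<ge>3. \<exists>f.
        pre_digraph.digraph_isomorphism (complement_graph (path_graph n)) f \<and>
        ?H \<restriction> (N \<union> Q) = app_iso f (complement_graph (path_graph n)) \<and>
        Q = iso_verts f ` {0, n - 1})"
    proof (cases "induced_cycle (\<lambda>x y. x \<noteq> y \<and> \<not> x \<rightarrow> y) n q \<and> (\<forall>i\<in>Q. \<forall>j\<in>Q. i = j)")
      case True
      then have "card Q \<le> 1" using finQ by (simp add: card_le_Suc0_iff_eq)
      then have "card Q = 0 \<or> card Q = 1" by linarith
      have iso_NQ: "digraph_iso (complement_graph (cycle_graph n)) (?H \<restriction> (N \<union> Q))"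
        using iso unfolding NQ restr complement_cycle_labelled_copy[OF True[THEN conjunct1], symmetric]
          digraph_iso_def by (intro exI[of _ ?id]) simp
      show ?thesis
      proof (rule disjE[OF \<open>card Q = 0 \<or> card Q = 1\<close>])
        assume Q0: "card Q = 0"
        then have "N \<union> Q = N" using finQ by simp
        then have iso_N: "digraph_iso (complement_graph (cycle_graph n)) (?H \<restriction> N)"
          using iso_NQ by (simp only:)
        show ?thesis by (intro disjI1 conjI Q0 exI[of _ n] n3 iso_N)
      next
        assume Q1: "card Q = 1"
        show ?thesis
          by (rule disjI2, rule disjI1, intro conjI Q1 exI[of _ n] n3 iso_NQ)
      qed
    next
      case False
      define L where "L = {x. v \<rightarrow> x \<and> (x \<rightarrow> u) \<noteq> (x \<rightarrow> w)}"
      have qQ: "q i \<in> L \<longleftrightarrow> i \<in> Q" if "i < n" for i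
        using vq[OF that] that by (simp add: Q_def L_def)
      have "(\<forall>i<n. \<forall>j<n. q i \<in> L \<longrightarrow> q j \<in> L \<longrightarrow> i = j) \<longrightarrow> (\<forall>i\<in>Q. \<forall>j\<in>Q. i = j)"
        using Qn by (simp add: qQ cong: imp_cong)
      then have "induced_path (\<lambda>x y. x \<noteq> y \<and> \<not> x \<rightarrow> y) n q \<and> (\<forall>i<n. q i \<in> L \<longleftrightarrow> i = 0 \<or> i = n - 1)"
        using pat False unfolding F_pattern_def L_def[symmetric] by argo
      then have path: "induced_path (\<lambda>x y. x \<noteq> y \<and> \<not> x \<rightarrow> y) n q"
        and ends: "\<And>i. i < n \<Longrightarrow> q i \<in> L \<longleftrightarrow> i = 0 \<or> i = n - 1"
        by simp_all
      have Q: "i \<in> Q \<longleftrightarrow> i = 0 \<or> i = n - 1" if "i < n" for i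
        using qQ[OF that] ends[OF that] by argo
      have Q: "Q = {0, n - 1}"
      proof (intro set_eqI)
        show "i \<in> Q \<longleftrightarrow> i \<in> {0, n - 1}" for i
          using Q[of i] Qn[of i] n3 by (cases "i < n") auto
      qed
      have Q2: "card Q = 2" using Q n3 by auto
      have Q_img: "Q = iso_verts ?id ` {0, n - 1}" using Q by simp
      have path_iso: "pre_digraph.digraph_isomorphism (complement_graph (path_graph n)) ?id"
        "?H \<restriction> (N \<union> Q) = app_iso ?id (complement_graph (path_graph n))"
        using iso unfolding NQ restr complement_path_labelled_copy[OF path] by simp_all
      show ?thesis
        by (intro disjI2 conjI Q2 exI[of _ n] n3 exI[of _ ?id] path_iso Q_img)
    qed
    have "distinct [n + 1, n, n + 2]" by simp
    have "{n + 1, n, n + 2} \<inter> N = {}" "{n + 1, n, n + 2} \<inter> Q = {}" "N \<inter> Q = {}"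
      unfolding N_def Q_def by auto
    have "verts ?H = {n + 1, n, n + 2} \<union> N \<union> Q"
    proof -
      have "verts ?H = {..<n + 3}" by (simp add: labelled_copy_def)
      also have "\<dots> = {n + 1, n, n + 2} \<union> {..<n}" by auto
      finally show ?thesis using NQ by (simp add: Un_assoc)
    qed
    have "independent_set ?H {n + 1, n, n + 2}"
    proof -
      have "{n + 1, n, n + 2} \<subseteq> verts ?H" by (simp add: labelled_copy_def)
      moreover have "h i \<in> {u, v, w}" if "i \<in> {n + 1, n, n + 2}" for i
        using that h3 by blast
      then have "\<not> i \<rightarrow>\<^bsub>?H\<^esub> j" if "i \<in> {n + 1, n, n + 2}" "j \<in> {n + 1, n, n + 2}" for i j
        using that nadj unfolding adj by blast
      ultimately show ?thesis unfolding independent_set_def by blast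
    qed
    have "\<forall>x\<in>N \<union> Q. n \<rightarrow>\<^bsub>?H\<^esub> x"
      unfolding NQ adj by (simp add: h h3 vq)
    have "\<forall>x\<in>N. x \<rightarrow>\<^bsub>?H\<^esub> (n + 1) \<and> x \<rightarrow>\<^bsub>?H\<^esub> (n + 2)"
      unfolding adj h3 by (simp add: h N_def)
    have "\<forall>x\<in>Q. (x \<rightarrow>\<^bsub>?H\<^esub> (n + 1)) \<noteq> (x \<rightarrow>\<^bsub>?H\<^esub> (n + 2))"
      unfolding adj h3 by (simp add: h Q_def)
    show ?thesis
      unfolding family_F_def mem_Collect_eq
      by (intro conjI graph_labelled_copy, rule exI[of _ "n + 1"], rule exI[of _ n],
          rule exI[of _ "n + 2"], rule exI[of _ N], rule exI[of _ Q], intro conjI; fact)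
  qed
  ultimately show False by blast
qed

section \<open>Avoiding a vertex of maximum degree\<close>

lemma out_degree_conv: "out_degree G x = card {y. x \<rightarrow> y}"
proof -
  have "inj_on (head G) (out_arcs G x)"
    by (rule inj_onI) (auto simp: arc_to_ends_def intro: no_multi_arcs)
  moreover have "head G ` out_arcs G x = {y. x \<rightarrow> y}"
    by (auto simp: arcs_ends_conv image_iff)
  ultimately show ?thesis unfolding out_degree_def by (metis card_image)
qed

lemma finite_neighbours: "finite {y. x \<rightarrow> y}"
  by (rule finite_subset[OF _ finite_verts]) (auto dest: adj_in_verts)

text \<open>
  The deletion of \<open>v\<close> does not lower the independence number. If it did, the set system of the
  neighbours in \<open>I - {v}\<close>, indexed by the neighbours of \<open>v\<close>, would satisfy all hypotheses of the
  lemma \<open>ex_F_pattern_set_system\<close> and hence produce a member of the family.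
\<close>

lemma independent_set_avoiding_max_degree_vertex:
  assumes free: "free_of G (family_F \<union> {path_graph 5})"
    and edge: "\<not> independent_set G (verts G)"
    and max: "\<And>x. x \<in> verts G \<Longrightarrow> out_degree G x \<le> out_degree G v"
    and I: "independent_set G I"
  shows "\<exists>J. independent_set G J \<and> v \<notin> J \<and> card I \<le> card J"
proof (rule ccontr)
  assume "\<not> ?thesis"
  then have small: "card J < card I" if "independent_set G J" "v \<notin> J" for J
    using that by (meson not_le)
  have vI: "v \<in> I" using small[OF I] by blast
  have Iadj: "\<not> x \<rightarrow> y" if "x \<in> I" "y \<in> I" for x y
    using I that by (auto simp: independent_set_def)
  have IV: "I \<subseteq> verts G" using I by (simp add: independent_set_def)
  have finI: "finite I" using IV finite_verts by (rule finite_subset)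
  define A where "A = {y. v \<rightarrow> y}"
  define S where "S y = {a \<in> I - {v}. y \<rightarrow> a}" for y
  define R where "R = (\<lambda>x y. x \<noteq> y \<and> \<not> x \<rightarrow> y)"
  have finA: "finite A" unfolding A_def by (rule finite_neighbours)
  have finS: "finite (S y)" for y using finI by (simp add: S_def)
  have AI: "A \<inter> I = {}" using Iadj[OF vI] by (auto simp: A_def)
  have AV: "A \<subseteq> verts G" by (auto simp: A_def dest: adj_in_verts)
  have "A \<noteq> {}"
  proof -
    obtain x y where "x \<rightarrow> y" using edge by (auto simp: independent_set_def)
    then have "0 < out_degree G x" using finite_neighbours[of x] by (auto simp: out_degree_conv card_gt_0_iff)
    then have "0 < out_degree G v" using max[of x] \<open>x \<rightarrow> y\<close> adj_in_verts by fastforce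
    then show ?thesis by (metis A_def card.empty less_irrefl out_degree_conv)
  qed
  \<comment> \<open>Replacing \<open>v\<close> and the neighbours of \<open>T\<close> in \<open>I\<close> by \<open>T\<close> gives an independent set without \<open>v\<close>.\<close>
  have exchange: "card T \<le> card (\<Union> (S ` T))"
    if T: "T \<subseteq> A" and nadj: "\<And>x y. x \<in> T \<Longrightarrow> y \<in> T \<Longrightarrow> \<not> x \<rightarrow> y" for T
  proof -
    let ?U = "\<Union> (S ` T)"
    let ?J = "(I - {v} - ?U) \<union> T"
    have U: "?U \<subseteq> I - {v}" by (auto simp: S_def)
    have cross: "\<not> t \<rightarrow> a" "\<not> a \<rightarrow> t" if "t \<in> T" "a \<in> I - {v} - ?U" for t a
      using that adj_sym[of a t] by (auto simp: S_def)
    have "\<not> x \<rightarrow> y" if "x \<in> ?J" "y \<in> ?J" for x y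
      using that nadj[of x y] Iadj[of x y] cross[of x y] cross[of y x] by auto
    then have "independent_set G ?J"
      using IV AV T unfolding independent_set_def by blast
    moreover have "v \<notin> ?J" using AI vI T by blast
    ultimately have "card ?J < card I" by (rule small)
    moreover have "card ?J = card (I - {v} - ?U) + card T"
      using finI T finA AI by (intro card_Un_disjoint) (auto dest: finite_subset)
    moreover have "card (I - {v} - ?U) = card I - 1 - card ?U"
      using U finI vI by (subst card_Diff_subset) (auto intro: finite_subset)
    moreover have "card ?U \<le> card I - 1"
      using card_mono[OF _ U] finI vI by simp
    moreover have "1 \<le> card I" using vI finI by (simp add: Suc_le_eq card_gt_0_iff) blast
    ultimately show ?thesis by linarith
  qed
  have "\<exists>x\<in>A. \<exists>u\<in>S x. \<exists>w\<in>S x. u \<noteq> w \<and>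
    (\<exists>n q. F_pattern R {y\<in>A. u \<in> S y \<and> w \<in> S y} {y\<in>A. (u \<in> S y) \<noteq> (w \<in> S y)} n q)"
  proof (rule ex_F_pattern_set_system[OF finA \<open>A \<noteq> {}\<close>])
    show "symp R" using adj_sym by (auto simp: R_def symp_def)
    show "\<not> R x x" for x by (simp add: R_def)
    show "finite (S x)" for x by (rule finS)
    show "S x \<noteq> {}" if "x \<in> A" for x
    proof -
      have "card {x} \<le> card (\<Union> (S ` {x}))"
        by (rule exchange) (use that adj_not_same in auto)
      then show ?thesis by auto
    qed
    show "2 \<le> card (S x \<union> S y)" if "x \<in> A" "y \<in> A" "R x y" for x y
    proof -
      have "\<not> x \<rightarrow> y" "\<not> y \<rightarrow> x" "x \<noteq> y" using \<open>R x y\<close> adj_sym[of x y] by (auto simp: R_def)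
      moreover have "card {x, y} \<le> card (\<Union> (S ` {x, y}))"
        by (rule exchange) (use that calculation adj_not_same in auto)
      ultimately show ?thesis by simp
    qed
    show "card (S x) \<le> card {y \<in> A. R x y}" if x: "x \<in> A" for x
    proof -
      \<comment> \<open>The neighbours \<open>v\<close> and \<open>S x\<close> of \<open>x\<close> outside \<open>A\<close> are compensated by non-neighbours in \<open>A\<close>.\<close>
      let ?B = "{y \<in> A. x \<rightarrow> y}" and ?C = "{y \<in> A. R x y}"
      have vx: "v \<notin> S x" "x \<rightarrow> v" using x adj_sym[of x v] by (auto simp: S_def A_def)
      have "A = insert x (?B \<union> ?C)" using x by (auto simp: R_def)
      moreover have "x \<notin> ?B \<union> ?C" using adj_not_same[of x] by (auto simp: R_def)
      moreover have "?B \<inter> ?C = {}" by (auto simp: R_def)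
      ultimately have "card A = Suc (card ?B + card ?C)"
        using finA card_Un_disjoint[of ?B ?C] card_insert_disjoint[of "?B \<union> ?C" x] by simp
      moreover have "card (insert v (S x) \<union> ?B) = Suc (card (S x)) + card ?B"
        using finS finA vx(1) AI vI by (subst card_Un_disjoint) (auto simp: S_def)
      moreover have "card (insert v (S x) \<union> ?B) \<le> card {y. x \<rightarrow> y}"
        using vx by (intro card_mono finite_neighbours) (auto simp: S_def)
      moreover have "card {y. x \<rightarrow> y} \<le> card A"
        using max[of x] x AV by (auto simp: out_degree_conv A_def)
      ultimately show ?thesis by linarith
    qed
    show "S x \<subseteq> S y \<or> S y \<subseteq> S x" if "x \<in> A" "y \<in> A" "R x y" for x y
    proof (rule ccontr)
      assume "\<not> ?thesis"
      then obtain a b where ab: "a \<in> S x" "a \<notin> S y" "b \<in> S y" "b \<notin> S x" by blast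
      \<comment> \<open>These two elements extend \<open>x, v, y\<close> to an induced path on five vertices.\<close>
      let ?p = "\<lambda>i. [a, x, v, y, b] ! i"
      have I3: "a \<in> I" "b \<in> I" using ab by (auto simp: S_def)
      have out: "x \<rightarrow> a" "v \<rightarrow> x" "v \<rightarrow> y" "y \<rightarrow> b"
        using ab that by (auto simp: S_def A_def)
      then have yes: "a \<rightarrow> x" "x \<rightarrow> a" "x \<rightarrow> v" "v \<rightarrow> x" "v \<rightarrow> y" "y \<rightarrow> v" "y \<rightarrow> b" "b \<rightarrow> y"
        using adj_sym by blast+
      have "\<not> y \<rightarrow> a" "\<not> x \<rightarrow> b" "\<not> x \<rightarrow> y"
        using ab that by (auto simp: S_def R_def)
      then have no: "\<not> a \<rightarrow> y" "\<not> y \<rightarrow> a" "\<not> b \<rightarrow> x" "\<not> x \<rightarrow> b" "\<not> x \<rightarrow> y" "\<not> y \<rightarrow> x"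
        using adj_sym by blast+
      have I_no: "\<not> a \<rightarrow> a" "\<not> a \<rightarrow> v" "\<not> a \<rightarrow> b" "\<not> v \<rightarrow> a" "\<not> v \<rightarrow> v" "\<not> v \<rightarrow> b"
        "\<not> b \<rightarrow> a" "\<not> b \<rightarrow> v" "\<not> b \<rightarrow> b"
        using Iadj I3 vI by simp_all
      have loops: "\<not> x \<rightarrow> x" "\<not> y \<rightarrow> y" using adj_not_same by blast+
      have neq: "distinct [a, x, v, y, b]"
        using that ab AI I3 vI by (auto simp: S_def R_def)
      have five: "(\<forall>i<5. P i) \<longleftrightarrow> P 0 \<and> P 1 \<and> P 2 \<and> P 3 \<and> P 4" for P :: "nat \<Rightarrow> bool"
        by (auto simp: numeral_eq_Suc less_Suc_eq)
      have "induced_path (dominates G) 5 ?p"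
        unfolding induced_path_def
      proof
        show "inj_on ?p {..<5}" using neq by (auto simp: inj_on_def nth_eq_iff_index_eq)
        show "\<forall>i<5. \<forall>j<5. ?p i \<rightarrow> ?p j \<longleftrightarrow> j = i + 1 \<or> i = j + 1"
          unfolding five by (simp add: yes no I_no loops)
      qed
      moreover have "inj_on ?p {..<5}" using calculation by (simp add: induced_path_def)
      moreover have "?p ` {..<5} \<subseteq> verts G"
      proof -
        have "\<forall>i<5. ?p i \<in> verts G"
          unfolding five using adj_in_verts[OF yes(1)] adj_in_verts[OF yes(4)] adj_in_verts[OF yes(7)] by simp
        then show ?thesis by auto
      qed
      ultimately show False
        using free_of_labelled_copy[OF free, of ?p 5] path_graph_labelled_copy[of 5 ?p] by simp
    qed
  qed
  then obtain x u w n q where uw: "u \<in> S x" "w \<in> S x" "u \<noteq> w"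
    and pat: "F_pattern R {y\<in>A. u \<in> S y \<and> w \<in> S y} {y\<in>A. (u \<in> S y) \<noteq> (w \<in> S y)} n q"
    by blast
  have mem: "u \<in> I" "w \<in> I" "u \<noteq> v" "w \<noteq> v" using uw by (auto simp: S_def)
  have "F_pattern R {x. v \<rightarrow> x \<and> x \<rightarrow> u \<and> x \<rightarrow> w} {x. v \<rightarrow> x \<and> (x \<rightarrow> u) \<noteq> (x \<rightarrow> w)} n q"
    by (rule F_pattern_mono[OF pat]) (use mem in \<open>auto simp: A_def S_def\<close>)
  moreover have "independent_set G {u, v, w}"
    using mem vI Iadj IV by (auto simp: independent_set_def)
  moreover have "distinct [u, v, w]" using mem uw by auto
  moreover have "free_of G family_F" using free by (auto simp: free_of_def)
  ultimately show False using F_pattern_family_F unfolding R_def by blast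
qed

section \<open>Runs of the heuristic\<close>

lemma induced_subgraph_del_vert: "induced_subgraph (del_vert v) G"
  using subgraph_del_vert by (rule induced_subgraphI) (auto simp: del_vert_simps)

lemma graph_del_vert: "graph (del_vert v)"
  using digraphI_induced[OF induced_subgraph_del_vert]
    induced_graph_imp_symmetric[OF sym_arcs induced_subgraph_del_vert]
  by (rule digraph.graphI)

lemma free_of_del_vert:
  assumes "free_of G \<H>"
  shows "free_of (del_vert v) \<H>"
proof -
  have "induced_subgraph K G" if "induced_subgraph K (del_vert v)" for K
    using that subgraph_del_vert[of v] wf_digraph
    by (auto simp: induced_subgraph_def subgraph_def compatible_def del_vert_simps)
  then show ?thesis using assms unfolding free_of_def by blast
qed

lemma independent_set_del_vert:
  "independent_set (del_vert v) J \<longleftrightarrow> independent_set G J \<and> v \<notin> J"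
  by (auto simp: independent_set_def del_vert_simps arcs_ends_conv image_iff) blast+

end

text \<open>
  The set produced from the graph without \<open>v\<close> is maximum there, and by
  \<open>independent_set_avoiding_max_degree_vertex\<close> no independent set through \<open>v\<close> can be larger.
\<close>

lemma maxine_maximum:
  assumes "maxine G I" "graph G" "free_of G (family_F \<union> {path_graph 5})"
  shows "independent_set G I \<and> (\<forall>J. independent_set G J \<longrightarrow> card J \<le> card I)"
  using assms
proof (induction rule: maxine.induct)
  case (stop G)
  interpret graph G by fact
  show ?case using stop by (auto simp: independent_set_def intro: card_mono)
next
  case (delete G v I)
  interpret graph G by fact
  have IH: "independent_set G I" "v \<notin> I"
    "\<And>J. independent_set G J \<Longrightarrow> v \<notin> J \<Longrightarrow> card J \<le> card I"
    using delete.IH graph_del_vert free_of_del_vert[OF delete.prems(2)]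
    by (auto simp: independent_set_del_vert)
  have "card J \<le> card I" if J: "independent_set G J" for J
    using independent_set_avoiding_max_degree_vertex[OF delete.prems(2) delete.hyps(1) _ J, of v]
      delete.hyps(3) IH(3) by (meson order.trans)
  then show ?case using IH(1) by blast
qed

theorem corollary2p5:
  fixes G :: "('a, 'b) pre_digraph"
  assumes "graph G"
    and "free_of G (family_F \<union> {path_graph 5})"
  shows "\<forall>I. maxine G I \<longrightarrow> independent_set G I \<and> card I = independence_number G"
proof (intro allI impI)
  fix I assume "maxine G I"
  from maxine_maximum[OF this assms] have I: "independent_set G I"
    and max: "\<And>J. independent_set G J \<Longrightarrow> card J \<le> card I" by blast+
  interpret graph G by fact
  have "finite {J. independent_set G J}"
    by (rule finite_subset[of _ "Pow (verts G)"]) (auto simp: independent_set_def)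
  then have "independence_number G = card I"
    unfolding independence_number_def using I max by (intro Max_eqI) auto
  then show "independent_set G I \<and> card I = independence_number G" using I by simp
qed

end
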